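(* Let $a<b$ be real numbers, let $f:[a,b]\to\mathbb{R}$ be bounded and let $A\in\mathbb{R}$. The following two statements are equivalent: (1) the function $f$ is Riemann integrable on $[a,b]$ and $\int_a^b f(x)\,dx=A$; (2) every generalized primitive $F$ of $f$ on $[a,b]$ satisfies $F(b)-F(a)=A$.
   Context: Let $f:[a,b]\to\mathbb{R}$ be a bounded function. A generalized primitive of $f$ is a function $F:[a,b]\to\mathbb{R}$ such that for all $x,y\in[a,b]$ with $x<y$ we have $$\inf_{x\le z\le y} f(z)\le \frac{F(y)-F(x)}{y-x}\le \sup_{x\le z\le y} f(z).$$ *)

theory Defs
  imports "HOL-Analysis.Analysis"
begin

text \<open>Functions on [a, b] are total functions of which only the values on \<open>{a..b}\<close> are used.\<close>

definition generalized_primitive :: "real \<Rightarrow> real \<Rightarrow> (real \<Rightarrow> real) \<Rightarrow> (real \<Rightarrow> real) \<Rightarrow> bool" where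
  "generalized_primitive a b f F \<longleftrightarrow>
     (\<forall>x\<in>{a..b}. \<forall>y\<in>{a..b}. x < y \<longrightarrow>
        (INF z\<in>{x..y}. f z) \<le> (F y - F x) / (y - x) \<and>
        (F y - F x) / (y - x) \<le> (SUP z\<in>{x..y}. f z))"

text \<open>
  The library only has the Henstock--Kurzweil integral, where the fineness of a tagged division is
  controlled by a gauge. The Riemann integral uses the same tagged divisions and sums, but a
  uniform bound on the mesh. A tagged division may contain one-point intervals;
  they have length 0 and do not affect the sums.
\<close>

definition has_riemann_integral :: "(real \<Rightarrow> real) \<Rightarrow> real \<Rightarrow> real \<Rightarrow> real \<Rightarrow> bool" where
  "has_riemann_integral f I a b \<longleftrightarrow>
     (\<forall>e>0. \<exists>d>0. \<forall>p. p tagged_division_of {a..b} \<and> (\<forall>(t, K)\<in>p. measure lborel K < d) \<longrightarrow>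
        \<bar>(\<Sum>(t, K)\<in>p. f t * measure lborel K) - I\<bar> < e)"

definition riemann_integrable :: "(real \<Rightarrow> real) \<Rightarrow> real \<Rightarrow> real \<Rightarrow> bool" where
  "riemann_integrable f a b \<longleftrightarrow> (\<exists>I. has_riemann_integral f I a b)"

definition riemann_integral :: "(real \<Rightarrow> real) \<Rightarrow> real \<Rightarrow> real \<Rightarrow> real" where
  "riemann_integral f a b = (THE I. has_riemann_integral f I a b)"

end

theory Submission
  imports Defs
begin

text \<open>
  Let \<open>f\<close> be Riemann integrable and \<open>F\<close> a generalized primitive. On every piece of a division the
  increment of \<open>F\<close> is at most the supremum of \<open>f\<close> times the length of the piece. With suitably chosen
  tags the increments are therefore almost dominated by the terms of a Riemann sum. They telescope
  to \<open>F b - F a\<close>, which is hence at most the integral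
  (\<open>upper_primitive_le_riemann_integral\<close>); the same argument for \<open>- f\<close> and \<open>- F\<close> gives equality.

  Conversely, suppose that the Riemann sums of \<open>f\<close> do not converge to \<open>A\<close> as the mesh tends to 0.
  Then there are divisions with mesh tending to 0 whose Riemann sums keep a distance
  \<open>e > 0\<close> from \<open>A\<close>. A Riemann sum is the total increment of the primitive of the step function that takes on
  each piece the value of \<open>f\<close> at its tag. This primitive satisfies the defining inequalities of a
  generalized primitive up to an error proportional to the mesh, as the pieces that are
  tagged outside \<open>{x..y}\<close> meet it only near its end points (\<open>step_primitive_almost_upper\<close>). The primitives are
  uniformly bounded, so by Tychonoff's theorem they have a pointwise cluster point \<open>F\<close>
  (\<open>bounded_functions_pointwise_cluster\<close>). The errors vanish in the limit, so that \<open>F\<close> is a generalized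
  primitive, but \<open>\<bar>F b - F a - A\<bar> \<ge> e\<close>.
\<close>

section \<open>Tagged divisions of a compact interval\<close>

lemma tagged_division_piece:
  fixes a b :: real
  assumes "p tagged_division_of {a..b}" and "(t, K) \<in> p"
  shows "Inf K \<le> t" "t \<le> Sup K" "a \<le> Inf K" "Sup K \<le> b"
    "measure lborel K = Sup K - Inf K"
proof -
  have "t \<in> K" "K \<subseteq> {a..b}" using tagged_division_ofD[OF assms(1)] assms(2) by blast+
  moreover obtain u v where K: "K = {u..v}"
    using tagged_division_ofD(4)[OF assms] by auto
  ultimately have *: "u \<le> v" "u \<le> t" "t \<le> v" "a \<le> u" "v \<le> b" by auto
  then show "Inf K \<le> t" "t \<le> Sup K" "a \<le> Inf K" "Sup K \<le> b"
    "measure lborel K = Sup K - Inf K" using K by auto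
qed

lemma sum_telescope_tagged_division:
  fixes g :: "real \<Rightarrow> real"
  assumes "p tagged_division_of {a..b}" and "a \<le> b"
  shows "(\<Sum>(t, K)\<in>p. g (Sup K) - g (Inf K)) = g b - g a"
  using additive_tagged_division_1[OF assms(2,1), of g] .

text \<open>The tags may be prescribed as a function of the end points because a one-piece division of a
  short interval works with any tag, and divisions of adjacent intervals can be joined.\<close>

lemma fine_tagged_division_exists:
  fixes \<tau> :: "real \<Rightarrow> real \<Rightarrow> real"
  assumes "a \<le> b" and "d > 0" and \<tau>: "\<And>u v. u \<le> v \<Longrightarrow> u \<le> \<tau> u v \<and> \<tau> u v \<le> v"
  obtains p where "p tagged_division_of {a..b}" "\<forall>(t, K)\<in>p. measure lborel K < d"
    "\<forall>(t, K)\<in>p. t = \<tau> (Inf K) (Sup K)"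
proof -
  have "\<exists>p. p tagged_division_of {a..b} \<and>
          (\<forall>(t, K)\<in>p. measure lborel K < d \<and> t = \<tau> (Inf K) (Sup K))"
    using \<open>a \<le> b\<close>
  proof (induction rule: Bolzano)
    case (trans u v w)
    then obtain p q where
      p: "p tagged_division_of {u..v}" "\<forall>(t, K)\<in>p. measure lborel K < d \<and> t = \<tau> (Inf K) (Sup K)" and
      q: "q tagged_division_of {v..w}" "\<forall>(t, K)\<in>q. measure lborel K < d \<and> t = \<tau> (Inf K) (Sup K)"
      by blast
    have "interior {u..v} \<inter> interior {v..w} = {}" by auto
    from tagged_division_Un[OF p(1) q(1) this] have "(p \<union> q) tagged_division_of {u..w}"
      using trans by (simp add: ivl_disj_un_two_touch)
    with p q show ?case by blast
  next
    case (local x)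
    show ?case
    proof (intro exI[of _ d] conjI allI impI)
      fix u v assume "u \<le> x \<and> x \<le> v \<and> v - u < d"
      then have "u \<le> v" "v - u < d" by auto
      moreover have "{(\<tau> u v, {u..v})} tagged_division_of {u..v}"
        using tagged_division_of_self_real[of "\<tau> u v" u v] \<tau>[OF \<open>u \<le> v\<close>] by simp
      ultimately show "\<exists>p. p tagged_division_of {u..v} \<and>
          (\<forall>(t, K)\<in>p. measure lborel K < d \<and> t = \<tau> (Inf K) (Sup K))"
        by (intro exI[of _ "{(\<tau> u v, {u..v})}"]) auto
    qed (use \<open>d > 0\<close> in auto)
  qed
  then show thesis using that by fast
qed

section \<open>The Riemann integral\<close>

lemma has_riemann_integral_unique:
  assumes "a \<le> b" "has_riemann_integral f I a b" "has_riemann_integral f J a b"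
  shows "I = J"
proof (rule ccontr)
  assume "I \<noteq> J"
  define e where "e = \<bar>I - J\<bar> / 2"
  have "e > 0" using \<open>I \<noteq> J\<close> by (simp add: e_def)
  obtain d where d: "d > 0" "\<And>p. p tagged_division_of {a..b} \<Longrightarrow> \<forall>(t, K)\<in>p. measure lborel K < d \<Longrightarrow>
        \<bar>(\<Sum>(t, K)\<in>p. f t * measure lborel K) - I\<bar> < e"
    using assms(2) \<open>e > 0\<close> unfolding has_riemann_integral_def by meson
  obtain d' where d': "d' > 0" "\<And>p. p tagged_division_of {a..b} \<Longrightarrow> \<forall>(t, K)\<in>p. measure lborel K < d' \<Longrightarrow>
        \<bar>(\<Sum>(t, K)\<in>p. f t * measure lborel K) - J\<bar> < e"
    using assms(3) \<open>e > 0\<close> unfolding has_riemann_integral_def by meson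
  obtain p where p: "p tagged_division_of {a..b}" "\<forall>(t, K)\<in>p. measure lborel K < min d d'"
    using fine_tagged_division_exists[OF \<open>a \<le> b\<close>, of "min d d'" "\<lambda>u v. u"] d(1) d'(1)
    by (metis min_less_iff_conj order_refl)
  have "\<bar>(\<Sum>(t, K)\<in>p. f t * measure lborel K) - I\<bar> < e" using p by (intro d) auto
  moreover have "\<bar>(\<Sum>(t, K)\<in>p. f t * measure lborel K) - J\<bar> < e" using p by (intro d') auto
  ultimately show False unfolding e_def by argo
qed

lemma riemann_integrable_and_integral_iff:
  assumes "a \<le> b"
  shows "riemann_integrable f a b \<and> riemann_integral f a b = A \<longleftrightarrow> has_riemann_integral f A a b"
  unfolding riemann_integrable_def riemann_integral_def
  using has_riemann_integral_unique[OF assms, of f] by (metis the_equality)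

lemma has_riemann_integral_uminus:
  assumes "has_riemann_integral f I a b"
  shows "has_riemann_integral (\<lambda>x. - f x) (- I) a b"
proof -
  have "\<bar>(\<Sum>(t, K)\<in>p. - f t * measure lborel K) - (- I)\<bar> =
      \<bar>(\<Sum>(t, K)\<in>p. f t * measure lborel K) - I\<bar>" for p :: "(real \<times> real set) set"
    by (simp add: case_prod_unfold sum_negf)
  then show ?thesis using assms unfolding has_riemann_integral_def by presburger
qed

section \<open>One-sided generalized primitives\<close>

text \<open>The upper half of the definition of a generalized primitive, with an arbitrary upper bound in
  place of the supremum. This form survives limits, and the lower half is the same condition
  for \<open>- f\<close> and \<open>- F\<close>, so that every argument is made only once.\<close>

definition upper_primitive :: "real \<Rightarrow> real \<Rightarrow> (real \<Rightarrow> real) \<Rightarrow> (real \<Rightarrow> real) \<Rightarrow> bool" where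
  "upper_primitive a b f F \<longleftrightarrow>
     (\<forall>x y S. a \<le> x \<and> x < y \<and> y \<le> b \<and> (\<forall>z\<in>{x..y}. f z \<le> S) \<longrightarrow> F y - F x \<le> S * (y - x))"

lemma generalized_primitive_iff_upper_primitives:
  assumes "bounded (f ` {a..b})"
  shows "generalized_primitive a b f F \<longleftrightarrow>
    upper_primitive a b f F \<and> upper_primitive a b (\<lambda>x. - f x) (\<lambda>x. - F x)"
proof -
  have bdd: "bdd_above (f ` {x..y})" "bdd_below (f ` {x..y})" if "a \<le> x" "y \<le> b" for x y
  proof -
    have "bounded (f ` {x..y})" using that by (intro bounded_subset[OF assms] image_mono) auto
    then show "bdd_above (f ` {x..y})" "bdd_below (f ` {x..y})"
      by (rule bounded_imp_bdd_above, rule bounded_imp_bdd_below)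
  qed
  have up: "(F y - F x) / (y - x) \<le> (SUP z\<in>{x..y}. f z) \<longleftrightarrow>
      (\<forall>S. (\<forall>z\<in>{x..y}. f z \<le> S) \<longrightarrow> F y - F x \<le> S * (y - x))"
    if "a \<le> x" "x < y" "y \<le> b" for x y
  proof -
    have "(SUP z\<in>{x..y}. f z) \<le> S" if "\<forall>z\<in>{x..y}. f z \<le> S" for S
      using that \<open>x < y\<close> by (intro cSUP_least) auto
    moreover have "\<forall>z\<in>{x..y}. f z \<le> (SUP z\<in>{x..y}. f z)"
      using bdd that by (auto intro: cSUP_upper)
    ultimately show ?thesis using \<open>x < y\<close> by (auto simp: pos_divide_le_eq[symmetric] intro: order_trans)
  qed
  have lo: "(INF z\<in>{x..y}. f z) \<le> (F y - F x) / (y - x) \<longleftrightarrow>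
      (\<forall>S. (\<forall>z\<in>{x..y}. - f z \<le> S) \<longrightarrow> - F y - - F x \<le> S * (y - x))"
    if "a \<le> x" "x < y" "y \<le> b" for x y
  proof -
    have le: "- S \<le> (INF z\<in>{x..y}. f z)" if "\<forall>z\<in>{x..y}. - f z \<le> S" for S
      using that \<open>x < y\<close> by (intro cINF_greatest) (auto simp: minus_le_iff)
    have ge: "\<forall>z\<in>{x..y}. - f z \<le> - (INF z\<in>{x..y}. f z)"
      using bdd that by (auto intro: cINF_lower)
    have eq: "- F y - - F x \<le> S * (y - x) \<longleftrightarrow> - S \<le> (F y - F x) / (y - x)" for S
      using \<open>x < y\<close> by (auto simp: pos_le_divide_eq algebra_simps)
    show ?thesis unfolding eq 
    proof (intro iffI allI impI)
      fix S assume "(INF z\<in>{x..y}. f z) \<le> (F y - F x) / (y - x)" "\<forall>z\<in>{x..y}. - f z \<le> S"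
      then show "- S \<le> (F y - F x) / (y - x)" using le by (meson order_trans)
    next
      assume "\<forall>S. (\<forall>z\<in>{x..y}. - f z \<le> S) \<longrightarrow> - S \<le> (F y - F x) / (y - x)"
      with ge have "- (- (INF z\<in>{x..y}. f z)) \<le> (F y - F x) / (y - x)" by blast
      then show "(INF z\<in>{x..y}. f z) \<le> (F y - F x) / (y - x)" by simp
    qed
  qed
  show ?thesis
  proof
    assume "generalized_primitive a b f F"
    then have "(INF z\<in>{x..y}. f z) \<le> (F y - F x) / (y - x)"
        "(F y - F x) / (y - x) \<le> (SUP z\<in>{x..y}. f z)" if "a \<le> x" "x < y" "y \<le> b" for x y
      using that unfolding generalized_primitive_def by auto
    then show "upper_primitive a b f F \<and> upper_primitive a b (\<lambda>x. - f x) (\<lambda>x. - F x)"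
      unfolding upper_primitive_def using up lo by blast
  next
    assume "upper_primitive a b f F \<and> upper_primitive a b (\<lambda>x. - f x) (\<lambda>x. - F x)"
    then show "generalized_primitive a b f F"
      unfolding generalized_primitive_def upper_primitive_def by (auto simp: up lo)
  qed
qed

text \<open>On each piece of a division some tag makes the Riemann term at least the increment of \<open>F\<close>, up
  to \<open>e\<close> times the length. The increments telescope, so that some arbitrarily fine Riemann
  sums are at least \<open>F b - F a - e * (b - a)\<close>.\<close>

lemma upper_primitive_le_riemann_integral:
  assumes "a < b" and F: "upper_primitive a b f F" and I: "has_riemann_integral f I a b"
  shows "F b - F a \<le> I"
proof (rule field_le_epsilon)
  fix \<epsilon> :: real assume "\<epsilon> > 0"
  define e where "e = \<epsilon> / (1 + (b - a))"
  have e: "e > 0" "e * (1 + (b - a)) = \<epsilon>" using \<open>\<epsilon> > 0\<close> \<open>a < b\<close> by (auto simp: e_def)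
  have "\<exists>t. u \<le> t \<and> t \<le> v \<and> (a \<le> u \<and> v \<le> b \<longrightarrow> F v - F u \<le> (f t + e) * (v - u))"
    if "u \<le> v" for u v
  proof (cases "a \<le> u \<and> u < v \<and> v \<le> b")
    case True
    show ?thesis
    proof (rule ccontr)
      assume "\<not> ?thesis"
      then have *: "(f t + e) * (v - u) < F v - F u" if "t \<in> {u..v}" for t using that True by force
      have "f t \<le> (F v - F u) / (v - u) - e" if "t \<in> {u..v}" for t
        using *[OF that] True by (simp add: field_simps)
      then have "F v - F u \<le> ((F v - F u) / (v - u) - e) * (v - u)"
        using F True unfolding upper_primitive_def by blast
      also have "\<dots> = F v - F u - e * (v - u)"
        unfolding left_diff_distrib[of _ e] using True by simp
      finally have "e * (v - u) \<le> 0" by simp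
      then show False using mult_pos_pos[of e "v - u"] True e(1) by linarith
    qed
  qed (use that in auto)
  then obtain \<tau> where \<tau>: "\<And>u v. u \<le> v \<Longrightarrow> u \<le> \<tau> u v \<and> \<tau> u v \<le> v"
      "\<And>u v. u \<le> v \<Longrightarrow> a \<le> u \<Longrightarrow> v \<le> b \<Longrightarrow> F v - F u \<le> (f (\<tau> u v) + e) * (v - u)"
    by metis
  obtain d where d: "d > 0" "\<And>p. p tagged_division_of {a..b} \<Longrightarrow> \<forall>(t, K)\<in>p. measure lborel K < d \<Longrightarrow>
        \<bar>(\<Sum>(t, K)\<in>p. f t * measure lborel K) - I\<bar> < e"
    using I \<open>e > 0\<close> unfolding has_riemann_integral_def by meson
  obtain p where p: "p tagged_division_of {a..b}" "\<forall>(t, K)\<in>p. measure lborel K < d"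
    "\<forall>(t, K)\<in>p. t = \<tau> (Inf K) (Sup K)"
    using fine_tagged_division_exists[OF less_imp_le[OF \<open>a < b\<close>] \<open>d > 0\<close>, of \<tau>] \<tau>(1) by blast
  have "F b - F a = (\<Sum>(t, K)\<in>p. F (Sup K) - F (Inf K))"
    using sum_telescope_tagged_division[OF p(1)] \<open>a < b\<close> by simp
  also have "\<dots> \<le> (\<Sum>(t, K)\<in>p. f t * measure lborel K + e * (Sup K - Inf K))"
  proof (rule sum_mono, clarify)
    fix t K assume tK: "(t, K) \<in> p"
    note piece = tagged_division_piece[OF p(1) tK]
    have "t = \<tau> (Inf K) (Sup K)" using p(3) tK by auto
    then show "F (Sup K) - F (Inf K) \<le> f t * measure lborel K + e * (Sup K - Inf K)"
      using \<tau>(2)[of "Inf K" "Sup K"] piece(1-4) unfolding piece(5) by (simp add: algebra_simps)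
  qed
  also have "\<dots> = (\<Sum>(t, K)\<in>p. f t * measure lborel K) + e * (\<Sum>(t, K)\<in>p. Sup K - Inf K)"
    by (simp add: case_prod_unfold sum.distrib sum_distrib_left)
  also have "\<dots> \<le> (I + e) + e * (b - a)"
    using d(2)[OF p(1,2)] sum_telescope_tagged_division[OF p(1), of "\<lambda>x. x"] \<open>a < b\<close> by simp
  finally show "F b - F a \<le> I + \<epsilon>" using e(2) by (simp add: algebra_simps)
qed

section \<open>Primitives of Riemann sums\<close>

text \<open>The integral up to \<open>x\<close> of the step function that has on each piece of the division the value of
  \<open>f\<close> at the tag: \<open>min x (Sup K) - min x (Inf K)\<close> is the length of the part of \<open>K\<close> to the left
  of \<open>x\<close>. It is defined for all real \<open>x\<close>, and constant outside the divided interval.\<close>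

definition step_primitive :: "(real \<Rightarrow> real) \<Rightarrow> (real \<times> real set) set \<Rightarrow> real \<Rightarrow> real" where
  "step_primitive f p x = (\<Sum>(t, K)\<in>p. f t * (min x (Sup K) - min x (Inf K)))"

lemma step_primitive_uminus: "step_primitive (\<lambda>x. - f x) p x = - step_primitive f p x"
  by (simp add: step_primitive_def case_prod_unfold sum_negf)

lemma step_primitive_total:
  assumes p: "p tagged_division_of {a..b}"
  shows "step_primitive f p b - step_primitive f p a = (\<Sum>(t, K)\<in>p. f t * measure lborel K)"
proof -
  have "step_primitive f p b = (\<Sum>(t, K)\<in>p. f t * measure lborel K)"
    unfolding step_primitive_def
  proof (rule sum.cong, simp, clarify)
    fix t K assume "(t, K) \<in> p"
    note piece = tagged_division_piece[OF p this]
    show "f t * (min b (Sup K) - min b (Inf K)) = f t * measure lborel K"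
      using piece(1-5) by simp
  qed
  moreover have "step_primitive f p a = 0"
    unfolding step_primitive_def
  proof (rule sum.neutral, clarify)
    fix t K assume "(t, K) \<in> p"
    note piece = tagged_division_piece[OF p this]
    show "f t * (min a (Sup K) - min a (Inf K)) = 0"
      using piece(1-4) by simp
  qed
  ultimately show ?thesis by simp
qed

lemma step_primitive_bounded:
  assumes p: "p tagged_division_of {a..b}" and "a \<le> b" and M: "\<And>x. x \<in> {a..b} \<Longrightarrow> \<bar>f x\<bar> \<le> M"
  shows "\<bar>step_primitive f p x\<bar> \<le> M * (b - a)"
proof -
  have "\<bar>step_primitive f p x\<bar> \<le> (\<Sum>(t, K)\<in>p. M * (Sup K - Inf K))"
    unfolding step_primitive_def
  proof (rule order_trans[OF sum_abs], rule sum_mono, clarify)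
    fix t K assume "(t, K) \<in> p"
    note piece = tagged_division_piece[OF p this]
    show "\<bar>f t * (min x (Sup K) - min x (Inf K))\<bar> \<le> M * (Sup K - Inf K)"
      unfolding abs_mult using piece M[of t] by (intro mult_mono) auto
  qed
  also have "\<dots> = M * (b - a)"
    using sum_telescope_tagged_division[OF p \<open>a \<le> b\<close>, of "\<lambda>x. x"]
    by (simp add: case_prod_unfold sum_distrib_left[symmetric])
  finally show ?thesis .
qed

text \<open>Pieces tagged inside \<open>{x..y}\<close> have slope at most \<open>S\<close>. A piece tagged outside meets \<open>{x..y}\<close>
  only within distance \<open>d\<close> of one of the end points, so that all of these together contribute an
  excess of at most \<open>2 * M\<close> times the length \<open>2 * d\<close>.\<close>

lemma step_primitive_almost_upper:
  assumes p: "p tagged_division_of {a..b}" and fine: "\<forall>(t, K)\<in>p. measure lborel K < d"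
    and M: "\<And>x. x \<in> {a..b} \<Longrightarrow> \<bar>f x\<bar> \<le> M"
    and xy: "a \<le> x" "x < y" "y \<le> b" "0 < d" "d \<le> y - x"
    and S: "\<And>z. z \<in> {x..y} \<Longrightarrow> f z \<le> S"
  shows "step_primitive f p y - step_primitive f p x \<le> S * (y - x) + 4 * M * d"
proof -
  define w where "w u K = min u (Sup K) - min u (Inf K)" for u :: real and K
  have tele: "(\<Sum>(t, K)\<in>p. w v K - w u K) = v - u" if "a \<le> u" "u \<le> v" "v \<le> b" for u v
  proof -
    have "(\<Sum>(t, K)\<in>p. w v K - w u K) =
        (\<Sum>(t, K)\<in>p. (min v (Sup K) - min u (Sup K)) - (min v (Inf K) - min u (Inf K)))"
      by (simp add: w_def algebra_simps)
    also have "\<dots> = (min v b - min u b) - (min v a - min u a)"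
      using sum_telescope_tagged_division[OF p, of "\<lambda>s. min v s - min u s"] that by simp
    finally show ?thesis using that by simp
  qed
  have "step_primitive f p y - step_primitive f p x = (\<Sum>(t, K)\<in>p. f t * (w y K - w x K))"
    by (simp add: step_primitive_def w_def case_prod_unfold sum_subtractf[symmetric] algebra_simps)
  also have "\<dots> \<le> (\<Sum>(t, K)\<in>p. S * (w y K - w x K)
      + 2 * M * ((w (x + d) K - w x K) + (w y K - w (y - d) K)))"
  proof (rule sum_mono, clarify)
    fix t K assume tK: "(t, K) \<in> p"
    note piece = tagged_division_piece[OF p tK]
    have len: "Sup K - Inf K < d" using fine tK piece(5) by auto
    have mono: "w u K \<le> w v K" if "u \<le> v" for u v
      using that piece(1,2) by (auto simp: w_def min_def)
    have M0: "M \<ge> 0" using M[of x] xy by auto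
    have "(f t - S) * (w y K - w x K) \<le> 2 * M * ((w (x + d) K - w x K) + (w y K - w (y - d) K))"
    proof (cases "t \<in> {x..y}")
      case True
      have "(f t - S) * (w y K - w x K) \<le> 0"
        using S[OF True] mono[of x y] xy by (intro mult_nonpos_nonneg) auto
      also have "\<dots> \<le> 2 * M * ((w (x + d) K - w x K) + (w y K - w (y - d) K))"
        using M0 mono[of x "x + d"] mono[of "y - d" y] xy by (intro mult_nonneg_nonneg) auto
      finally show ?thesis .
    next
      case False
      have "w y K - w x K \<le> (w (x + d) K - w x K) + (w y K - w (y - d) K)"
        using False len piece(1,2) xy by (auto simp: w_def min_def)
      moreover have "f t - S \<le> 2 * M" using S[of x] M[of x] M[of t] piece xy by auto
      ultimately show ?thesis
        using M0 mono[of x y] xy by (intro mult_mono) auto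
    qed
    then show "f t * (w y K - w x K) \<le> S * (w y K - w x K)
        + 2 * M * ((w (x + d) K - w x K) + (w y K - w (y - d) K))"
      by (simp add: left_diff_distrib)
  qed
  also have "\<dots> = S * (\<Sum>(t, K)\<in>p. w y K - w x K) + 2 * M *
      ((\<Sum>(t, K)\<in>p. w (x + d) K - w x K) + (\<Sum>(t, K)\<in>p. w y K - w (y - d) K))"
    by (simp only: case_prod_unfold sum.distrib sum_distrib_left distrib_left)
  also have "\<dots> = S * (y - x) + 4 * M * d"
    using xy by (simp add: tele)
  finally show ?thesis .
qed

section \<open>Limits of primitives of Riemann sums\<close>

text \<open>Tychonoff's theorem, in the form of convergence along a filter finer than the sequential one;
  the index set may be uncountable, so that a subsequence need not suffice.\<close>

lemma bounded_functions_pointwise_cluster: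
  fixes G :: "nat \<Rightarrow> 'a \<Rightarrow> real"
  assumes "\<And>n x. \<bar>G n x\<bar> \<le> C"
  obtains \<F> F where "\<F> \<noteq> bot" "\<F> \<le> sequentially" "\<And>x. ((\<lambda>n. G n x) \<longlongrightarrow> F x) \<F>"
proof -
  let ?U = "PiE UNIV (\<lambda>_::'a. {-C..C})"
  have "compactin (product_topology (\<lambda>_::'a. euclideanreal) UNIV) ?U"
    by (subst compactin_PiE) auto
  then have "compact ?U" by (simp add: euclidean_product_topology)
  moreover have "filtermap G sequentially \<noteq> bot" by (simp add: filtermap_bot_iff)
  moreover have "eventually (\<lambda>g. g \<in> ?U) (filtermap G sequentially)"
    using assms by (auto simp: eventually_filtermap abs_le_iff minus_le_iff PiE_UNIV_domain intro!: always_eventually)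
  ultimately obtain F where F: "inf (nhds F) (filtermap G sequentially) \<noteq> bot"
    unfolding compact_filter by blast
  define \<F> where "\<F> = inf (filtercomap G (nhds F)) sequentially"
  show thesis
  proof
    show "\<F> \<noteq> bot"
    proof
      assume "\<F> = bot"
      then have "eventually (\<lambda>_. False) \<F>" by simp
      then obtain P Q where P: "eventually P (nhds F)" and Q: "eventually Q sequentially"
        and PQ: "\<And>n. P (G n) \<Longrightarrow> Q n \<Longrightarrow> False"
        unfolding \<F>_def eventually_inf eventually_filtercomap by blast
      have "eventually (\<lambda>g. \<not> P g) (filtermap G sequentially)"
        unfolding eventually_filtermap using Q by (rule eventually_mono) (use PQ in blast)
      with P have "eventually (\<lambda>_. False) (inf (nhds F) (filtermap G sequentially))"
        unfolding eventually_inf by blast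
      with F show False by (simp add: trivial_limit_def)
    qed
    show "\<F> \<le> sequentially" by (simp add: \<F>_def)
    show "((\<lambda>n. G n x) \<longlongrightarrow> F x) \<F>" for x
    proof -
      have "filterlim G (nhds F) \<F>"
        unfolding \<F>_def filterlim_def by (meson filtermap_filtercomap filtermap_mono inf_le1 order_trans)
      moreover have "((\<lambda>g. g x) \<longlongrightarrow> F x) (nhds F)"
      proof (rule topological_tendstoI)
        fix T assume T: "open T" "F x \<in> T"
        have "open ((\<lambda>g::'a \<Rightarrow> real. g x) -` T)"
          by (rule open_vimage[OF T(1) continuous_on_product_coordinates])
        from eventually_nhds_in_open[OF this, of F] T(2)
        show "eventually (\<lambda>g. g x \<in> T) (nhds F)" by simp
      qed
      ultimately show ?thesis by (rule filterlim_compose[rotated])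
    qed
  qed
qed

lemma upper_primitive_limit:
  assumes p: "\<And>n. p n tagged_division_of {a..b}"
    and fine: "\<And>n. \<forall>(t, K)\<in>p n. measure lborel K < \<delta> n" and \<delta>: "\<And>n. \<delta> n > 0" "\<delta> \<longlonglongrightarrow> 0"
    and M: "\<And>x. x \<in> {a..b} \<Longrightarrow> \<bar>f x\<bar> \<le> M"
    and \<F>: "\<F> \<noteq> bot" "\<F> \<le> sequentially"
    and lim: "\<And>x. ((\<lambda>n. step_primitive f (p n) x) \<longlongrightarrow> F x) \<F>"
  shows "upper_primitive a b f F"
  unfolding upper_primitive_def
proof (intro allI impI, elim conjE)
  fix x y S assume xy: "a \<le> x" "x < y" "y \<le> b" and S: "\<forall>z\<in>{x..y}. f z \<le> S"
  have \<delta>_lim: "(\<delta> \<longlongrightarrow> 0) \<F>" using \<delta>(2) \<F>(2) by (rule tendsto_mono[rotated])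
  have "eventually (\<lambda>n. \<delta> n < y - x) \<F>" using \<delta>_lim xy by (intro order_tendstoD(2)) auto
  then have ev: "eventually (\<lambda>n. step_primitive f (p n) y - step_primitive f (p n) x
      \<le> S * (y - x) + 4 * M * \<delta> n) \<F>"
    by (rule eventually_mono)
      (use xy S \<delta>(1) in \<open>intro step_primitive_almost_upper[OF p fine M], auto\<close>)
  have lim_S: "((\<lambda>n. S * (y - x) + 4 * M * \<delta> n) \<longlongrightarrow> S * (y - x) + 4 * M * 0) \<F>"
    by (intro tendsto_intros \<delta>_lim)
  have lim_F: "((\<lambda>n. step_primitive f (p n) y - step_primitive f (p n) x) \<longlongrightarrow> F y - F x) \<F>"
    by (intro tendsto_intros lim)
  have "F y - F x \<le> S * (y - x) + 4 * M * 0"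
    by (rule tendsto_le[OF \<F>(1) lim_S lim_F ev])
  then show "F y - F x \<le> S * (y - x)" by simp
qed

text \<open>If the Riemann sums did not converge to \<open>A\<close>, some sequence of ever finer ones would stay away
  from \<open>A\<close>, and a cluster point of their primitives would be a generalized primitive whose
  increment over the whole interval differs from \<open>A\<close>.\<close>

lemma has_riemann_integral_if_generalized_primitives:
  assumes "a < b" and bdd: "bounded (f ` {a..b})"
    and prim: "\<And>F. generalized_primitive a b f F \<Longrightarrow> F b - F a = A"
  shows "has_riemann_integral f A a b"
proof (rule ccontr)
  assume "\<not> has_riemann_integral f A a b"
  then obtain e where e: "e > 0" and bad: "\<And>d. d > 0 \<Longrightarrow> \<exists>p. p tagged_division_of {a..b} \<and>
      (\<forall>(t, K)\<in>p. measure lborel K < d) \<and> e \<le> \<bar>(\<Sum>(t, K)\<in>p. f t * measure lborel K) - A\<bar>"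
    unfolding has_riemann_integral_def by (meson not_less)
  define \<delta> where "\<delta> n = inverse (real (Suc n))" for n
  have \<delta>: "\<delta> n > 0" "\<delta> \<longlonglongrightarrow> 0" for n
    unfolding \<delta>_def using LIMSEQ_inverse_real_of_nat by auto
  obtain p where p: "\<And>n. p n tagged_division_of {a..b}"
    and fine: "\<And>n. \<forall>(t, K)\<in>p n. measure lborel K < \<delta> n"
    and far: "\<And>n. e \<le> \<bar>(\<Sum>(t, K)\<in>p n. f t * measure lborel K) - A\<bar>"
    using bad[OF \<delta>(1)] by metis
  obtain M where M: "\<And>x. x \<in> {a..b} \<Longrightarrow> \<bar>f x\<bar> \<le> M"
    using bdd unfolding bounded_iff by (metis imageI real_norm_def)
  have "\<bar>step_primitive f (p n) x\<bar> \<le> M * (b - a)" for n x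
    using p less_imp_le[OF \<open>a < b\<close>] M by (rule step_primitive_bounded)
  then obtain \<F> F where \<F>: "\<F> \<noteq> bot" "\<F> \<le> sequentially"
    and lim: "\<And>x. ((\<lambda>n. step_primitive f (p n) x) \<longlongrightarrow> F x) \<F>"
    using bounded_functions_pointwise_cluster[of "\<lambda>n. step_primitive f (p n)" "M * (b - a)"] by blast
  have "upper_primitive a b f F"
    using p fine \<delta> M \<F> lim by (rule upper_primitive_limit)
  moreover have "upper_primitive a b (\<lambda>x. - f x) (\<lambda>x. - F x)"
  proof (rule upper_primitive_limit)
    show "\<bar>- f x\<bar> \<le> M" if "x \<in> {a..b}" for x using M[OF that] by simp
    show "((\<lambda>n. step_primitive (\<lambda>x. - f x) (p n) x) \<longlongrightarrow> - F x) \<F>" for x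
      unfolding step_primitive_uminus by (intro tendsto_minus lim)
  qed (fact p fine \<delta> \<F>)+
  ultimately have "F b - F a = A"
    using prim generalized_primitive_iff_upper_primitives[OF bdd] by blast
  have "((\<lambda>n. \<bar>(step_primitive f (p n) b - step_primitive f (p n) a) - A\<bar>)
      \<longlongrightarrow> \<bar>(F b - F a) - A\<bar>) \<F>"
    by (intro tendsto_intros lim)
  moreover have "e \<le> \<bar>(step_primitive f (p n) b - step_primitive f (p n) a) - A\<bar>" for n
    using far by (simp add: step_primitive_total[OF p])
  ultimately have "e \<le> \<bar>(F b - F a) - A\<bar>"
    using \<F>(1) by (intro tendsto_lowerbound) auto
  with \<open>F b - F a = A\<close> \<open>e > 0\<close> show False by simp
qed

theorem theorem2p3:
  fixes a b A :: real and f :: "real \<Rightarrow> real"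
  assumes "a < b"
    and "bounded (f ` {a..b})"
  shows "(riemann_integrable f a b \<and> riemann_integral f a b = A) \<longleftrightarrow>
         (\<forall>F. generalized_primitive a b f F \<longrightarrow> F b - F a = A)"
proof -
  have "F b - F a = A" if I: "has_riemann_integral f A a b" and "generalized_primitive a b f F" for F
  proof (rule antisym)
    have F: "upper_primitive a b f F" "upper_primitive a b (\<lambda>x. - f x) (\<lambda>x. - F x)"
      using that generalized_primitive_iff_upper_primitives[OF assms(2)] by auto
    show "F b - F a \<le> A"
      by (rule upper_primitive_le_riemann_integral[OF \<open>a < b\<close> F(1) I])
    show "A \<le> F b - F a"
      using upper_primitive_le_riemann_integral[OF \<open>a < b\<close> F(2) has_riemann_integral_uminus[OF I]]
      by simp
  qed
  then show ?thesis
    using riemann_integrable_and_integral_iff[of a b f A]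
      has_riemann_integral_if_generalized_primitives[OF assms] \<open>a < b\<close> by auto
qed

end
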